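(* Let $P$ be a default-enabled poset. If $g$ is a preclosure map on $P$, then $\mathrm{fix}(g)$ is a closure system in $P$, and the closure operator $h$ on $P$ with $\mathrm{fix}(h)=\mathrm{fix}(g)$ is the least closure operator above $g$. A subset of $P$ is a closure system in $P$ if and only if it obeys all default closure rules on $P$. Consequently, the set $\mathrm{ClSys}(P)$ of all closure systems in $P$ is a closure system in the powerset lattice $\mathcal{P}(P)$ (i.e. it is closed under arbitrary intersections), so it is a complete lattice in which the meets are intersections. Also the poset $\mathrm{Cl}(P)$ of all closure operators on $P$, being antiisomorphic to the poset $\mathrm{ClSys}(P)$, is a complete lattice.
   Context: A poset has a ceiling if each of its elements is below some maximal element of it (the empty poset has a ceiling); a subset of a poset has a ceiling if it does so as a subposet. A poset $P$ is default-enabled if for every subset $X\subseteq P$ the set of all lower bounds of $X$ in $P$ has a ceiling, i.e. every lower bound of $X$ is below some maximal lower bound of $X$ (including $X=\emptyset$, for which every element of $P$ is a lower bound). A closure rule on a set $E$ is a pair $(B,c)$ with $B\subseteq E$ and $c\in E$; a subset $X\subseteq E$ obeys it if $B\subseteq X$ implies $c\in X$. A default closure rule on a poset $P$ is a closure rule $(B,c)$ on $P$ such that $c$ is a maximal lower bound of $B$. A preclosure map on $P$ is a map $f:P\to P$ that is increasing and ascending ($x\le f(x)$); a closure operator is an idempotent preclosure map; maps are ordered pointwise. $\mathrm{fix}(f)$ is the set of fixed points of $f$. A closure system in $P$ is the fixpoint set of a closure operator on $P$; equivalently, a subset $C$ such that $\{y\in C: y\ge x\}$ has a least element for every $x\in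 P$. $\mathrm{ClSys}(P)$ is ordered by inclusion. The intersection of the empty set of subsets of $P$ is $P$. *)

theory Defs
  imports "HOL-Algebra.Complete_Lattice" "HOL-Library.FuncSet"
begin

text \<open>
  Posets are records satisfying \<^locale>\<open>partial_order\<close>; the carrier may be empty.
\<close>

definition maximal_in :: "[('a, 'b) gorder_scheme, 'a, 'a set] \<Rightarrow> bool"
  where "maximal_in P m A \<longleftrightarrow>
    A \<subseteq> carrier P \<and> m \<in> A \<and> (\<forall>x\<in>A. m \<sqsubseteq>\<^bsub>P\<^esub> x \<longrightarrow> x = m)"

definition has_ceiling :: "[('a, 'b) gorder_scheme, 'a set] \<Rightarrow> bool"
  where "has_ceiling P A \<longleftrightarrow> (\<forall>x\<in>A. \<exists>m. maximal_in P m A \<and> x \<sqsubseteq>\<^bsub>P\<^esub> m)"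

locale default_enabled = partial_order P for P (structure) +
  assumes Lower_has_ceiling: "X \<subseteq> carrier P \<Longrightarrow> has_ceiling P (Lower P X)"

definition closure_rules :: "'a set \<Rightarrow> ('a set \<times> 'a) set"
  where "closure_rules E = {(B, c). B \<subseteq> E \<and> c \<in> E}"

definition obeys :: "'a set \<Rightarrow> 'a set \<times> 'a \<Rightarrow> bool"
  where "obeys X r \<longleftrightarrow> (fst r \<subseteq> X \<longrightarrow> snd r \<in> X)"

definition default_closure_rules :: "('a, 'b) gorder_scheme \<Rightarrow> ('a set \<times> 'a) set"
  where "default_closure_rules P =
    {(B, c) \<in> closure_rules (carrier P). maximal_in P c (Lower P B)}"

text \<open>
  Self-maps of a poset are the functions in \<open>carrier P \<rightarrow>\<^sub>E carrier P\<close>, whose value outside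
  the carrier is \<^const>\<open>undefined\<close>; HOL equality of such functions is equality as maps on the
  carrier, so the pointwise order on them is antisymmetric.
\<close>

definition preclosure_map :: "('a, 'b) gorder_scheme \<Rightarrow> ('a \<Rightarrow> 'a) \<Rightarrow> bool"
  where "preclosure_map P f \<longleftrightarrow>
    f \<in> carrier P \<rightarrow>\<^sub>E carrier P \<and> isotone P P f \<and> (\<forall>x\<in>carrier P. x \<sqsubseteq>\<^bsub>P\<^esub> f x)"

definition closure_operator :: "('a, 'b) gorder_scheme \<Rightarrow> ('a \<Rightarrow> 'a) \<Rightarrow> bool"
  where "closure_operator P f \<longleftrightarrow> preclosure_map P f \<and> idempotent P f"

text \<open>The set of fixed points of a self-map \<open>f\<close> is the library's \<^term>\<open>fps P f\<close>.\<close>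

definition closure_system :: "('a, 'b) gorder_scheme \<Rightarrow> 'a set \<Rightarrow> bool"
  where "closure_system P C \<longleftrightarrow> (\<exists>f. closure_operator P f \<and> C = fps P f)"

definition map_order :: "('a, 'b) gorder_scheme \<Rightarrow> ('a \<Rightarrow> 'a) gorder"
  where "map_order P =
    \<lparr> carrier = carrier P \<rightarrow>\<^sub>E carrier P, eq = (=),
      le = (\<lambda>f g. \<forall>x\<in>carrier P. f x \<sqsubseteq>\<^bsub>P\<^esub> g x) \<rparr>"

definition Cl :: "('a, 'b) gorder_scheme \<Rightarrow> ('a \<Rightarrow> 'a) gorder"
  where "Cl P = map_order P\<lparr> carrier := {f. closure_operator P f} \<rparr>"

definition powerset_order :: "'a set \<Rightarrow> 'a set gorder"
  where "powerset_order A = \<lparr> carrier = Pow A, eq = (=), le = (\<subseteq>) \<rparr>"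

definition ClSys :: "('a, 'b) gorder_scheme \<Rightarrow> 'a set gorder"
  where "ClSys P = powerset_order (carrier P)\<lparr> carrier := {C. closure_system P C} \<rparr>"

definition order_antiiso ::
  "[('a, 'c) gorder_scheme, ('b, 'd) gorder_scheme, 'a \<Rightarrow> 'b] \<Rightarrow> bool"
  where "order_antiiso A B f \<longleftrightarrow>
    bij_betw f (carrier A) (carrier B) \<and> order_emb A (inv_gorder B) f"

end

theory Submission
  imports Defs
begin

text \<open>
  If \<open>g\<close> is a preclosure map and \<open>c\<close> is a maximal lower bound of a set \<open>B\<close> of fixed points of
  \<open>g\<close>, then \<open>g c\<close> is again a lower bound of \<open>B\<close>, so \<open>g c = c\<close>; hence fixpoint sets of preclosure
  maps obey all default closure rules. Conversely, let \<open>C\<close> obey them. Any \<open>x\<close> is a lower bound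
  of \<open>{y \<in> C. x \<sqsubseteq> y}\<close>, so it is below some maximal lower bound \<open>c\<close> of this set; the rule puts
  \<open>c\<close> into \<open>C\<close>, which makes \<open>c\<close> the least element of \<open>C\<close> above \<open>x\<close>.
\<close>

section \<open>Closure operators and closure systems on a poset\<close>

context partial_order
begin

lemma fps_eq: "fps L f = {x \<in> carrier L. f x = x}"
  by (simp add: fps_def eq_is_equal)

lemma preclosure_mapD:
  assumes "preclosure_map L g"
  shows "x \<in> carrier L \<Longrightarrow> g x \<in> carrier L"
    and "x \<notin> carrier L \<Longrightarrow> g x = undefined"
    and "x \<in> carrier L \<Longrightarrow> x \<sqsubseteq> g x"
    and "\<lbrakk>x \<in> carrier L; y \<in> carrier L; x \<sqsubseteq> y\<rbrakk> \<Longrightarrow> g x \<sqsubseteq> g y"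
  using assms by (auto simp: preclosure_map_def isotone_def PiE_iff extensional_def)

lemma closure_operatorD:
  assumes "closure_operator L f"
  shows "preclosure_map L f" and "x \<in> carrier L \<Longrightarrow> f (f x) = f x"
  using assms by (auto simp: closure_operator_def idempotent_def eq_is_equal)

lemma closure_operator_mem_fps:
  "\<lbrakk>closure_operator L f; x \<in> carrier L\<rbrakk> \<Longrightarrow> f x \<in> fps L f"
  by (simp add: fps_eq closure_operatorD preclosure_mapD)

text \<open>A fixed point \<open>x\<close> of \<open>g\<close> satisfies
  \<open>x \<sqsubseteq> f x \<sqsubseteq> g x = x\<close>, so antisymmetry applies.\<close>

lemma fps_antimono:
  assumes f: "preclosure_map L f" and g: "preclosure_map L g"
    and le: "\<And>x. x \<in> carrier L \<Longrightarrow> f x \<sqsubseteq> g x"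
  shows "fps L g \<subseteq> fps L f"
proof
  fix x assume "x \<in> fps L g"
  then have x: "x \<in> carrier L" and "g x = x" by (auto simp: fps_eq)
  then have "f x \<sqsubseteq> x" using le by force
  then show "x \<in> fps L f"
    using x preclosure_mapD[OF f] by (auto simp: fps_eq)
qed

text \<open>Idempotence makes \<open>g x\<close> a fixed point of \<open>g\<close>, hence of
  \<open>f\<close>, so \<open>f x \<sqsubseteq> f (g x) = g x\<close>. This converse of
  \<open>fps_antimono\<close> lets \<open>f\<close> be a mere preclosure map, so that it also
  compares a preclosure map with the closure operator sharing its fixed points.\<close>

lemma preclosure_map_le_closure_operator:
  assumes f: "preclosure_map L f" and g: "closure_operator L g"
    and sub: "fps L g \<subseteq> fps L f" and x: "x \<in> carrier L"
  shows "f x \<sqsubseteq> g x"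
proof -
  have "g x \<in> fps L f" using closure_operator_mem_fps[OF g x] sub by blast
  then have "f (g x) = g x" by (simp add: fps_eq)
  moreover have "f x \<sqsubseteq> f (g x)"
    using x preclosure_mapD[OF f] preclosure_mapD[OF closure_operatorD(1)[OF g]] by simp
  ultimately show ?thesis by simp
qed

text \<open>On the carrier the preceding comparison applies in both directions; outside it both maps
  are \<open>undefined\<close>.\<close>

lemma closure_operator_eqI:
  assumes f: "closure_operator L f" and g: "closure_operator L g"
    and eq: "fps L f = fps L g"
  shows "f = g"
proof
  fix x
  note f' = preclosure_mapD[OF closure_operatorD(1)[OF f]]
    and g' = preclosure_mapD[OF closure_operatorD(1)[OF g]]
  show "f x = g x"
  proof (cases "x \<in> carrier L")
    case True
    show ?thesis
      using preclosure_map_le_closure_operator[OF closure_operatorD(1)[OF f] g _ True]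
        preclosure_map_le_closure_operator[OF closure_operatorD(1)[OF g] f _ True]
        eq True f' g' by auto
  next
    case False
    then show ?thesis using f' g' by simp
  qed
qed

text \<open>The map sending each \<open>x\<close> to the least element of \<open>C\<close> above
  \<open>x\<close> is a closure operator with fixpoint set \<open>C\<close>.\<close>

lemma closure_systemI:
  assumes C: "C \<subseteq> carrier L"
    and least: "\<And>x. x \<in> carrier L \<Longrightarrow> \<exists>c. least L c {y \<in> C. x \<sqsubseteq> y}"
  shows "closure_system L C"
proof -
  \<comment> \<open>The choice is harmless, since least elements in a poset are unique. The value
    \<open>undefined\<close> off the carrier makes \<open>f\<close> extensional.\<close>
  define f where
    "f = (\<lambda>x. if x \<in> carrier L then SOME c. least L c {y \<in> C. x \<sqsubseteq> y} else undefined)"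
  have lst: "least L (f x) {y \<in> C. x \<sqsubseteq> y}" if "x \<in> carrier L" for x
    using least[OF that] that unfolding f_def by (auto intro: someI_ex)
  have fC: "f x \<in> C" and asc: "x \<sqsubseteq> f x" if "x \<in> carrier L" for x
    using least_mem[OF lst[OF that]] by auto
  have below: "f x \<sqsubseteq> y" if "x \<in> carrier L" "y \<in> C" "x \<sqsubseteq> y" for x y
    using least_le[OF lst] that by blast
  have fixC: "f y = y" if "y \<in> C" for y
  proof (rule le_antisym)
    show "y \<in> carrier L" using that C by blast
    then show "f y \<sqsubseteq> y" "y \<sqsubseteq> f y" "f y \<in> carrier L" using that C fC asc below by auto
  qed
  have "preclosure_map L f"
    unfolding preclosure_map_def
  proof (intro conjI ballI)
    show "f \<in> carrier L \<rightarrow>\<^sub>E carrier L"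
      using fC C by (auto simp: f_def PiE_iff extensional_def)
    show "isotone L L f"
    proof (rule isotoneI)
      fix x y assume xy: "x \<in> carrier L" "y \<in> carrier L" "x \<sqsubseteq> y"
      \<comment> \<open>So \<open>f y\<close> is one of the elements of \<open>C\<close> above
        \<open>x\<close>, and \<open>f x\<close> is the least of these.\<close>
      have "x \<sqsubseteq> f y" using xy asc fC C by (meson le_trans subsetD)
      then show "f x \<sqsubseteq> f y" using below fC xy by blast
    qed (rule weak_partial_order_axioms)+
  qed (rule asc)
  moreover have "idempotent L f"
    using fC fixC by (simp add: idempotent_def eq_is_equal)
  moreover have "C = fps L f"
    using fC fixC C by (force simp: fps_eq)
  ultimately show ?thesis
    unfolding closure_system_def closure_operator_def by blast
qed

section \<open>Posets of maps and of subsets; completeness along antiisomorphisms\<close>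

lemma partial_order_subset:
  "A \<subseteq> carrier L \<Longrightarrow> partial_order (L\<lparr>carrier := A\<rparr>)"
  by (simp add: partial_order_def partial_order_axioms_def eq_is_equal
      weak_partial_order_subset weak_partial_order_axioms)

text \<open>Antisymmetry holds for HOL equality because maps in the carrier agree outside
  \<open>carrier L\<close>.\<close>

lemma map_order_partial_order: "partial_order (map_order L)"
proof unfold_locales
  fix f g
  assume "f \<sqsubseteq>\<^bsub>map_order L\<^esub> g" "g \<sqsubseteq>\<^bsub>map_order L\<^esub> f"
    "f \<in> carrier (map_order L)" "g \<in> carrier (map_order L)"
  then have fg: "f \<in> carrier L \<rightarrow>\<^sub>E carrier L" "g \<in> carrier L \<rightarrow>\<^sub>E carrier L"
    and "\<forall>x\<in>carrier L. f x \<sqsubseteq> g x \<and> g x \<sqsubseteq> f x"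
    by (auto simp: map_order_def)
  then have "f x = g x" if "x \<in> carrier L" for x
    using that by (blast intro: le_antisym)
  with fg show "f .=\<^bsub>map_order L\<^esub> g"
    by (auto simp: map_order_def intro: PiE_ext)
next
  fix f g h
  assume "f \<sqsubseteq>\<^bsub>map_order L\<^esub> g" "g \<sqsubseteq>\<^bsub>map_order L\<^esub> h"
    "f \<in> carrier (map_order L)" "g \<in> carrier (map_order L)" "h \<in> carrier (map_order L)"
  then show "f \<sqsubseteq>\<^bsub>map_order L\<^esub> h"
    unfolding map_order_def by (auto intro: le_trans)
qed (auto simp: map_order_def PiE_iff)

lemma Cl_partial_order: "partial_order (Cl L)"
  unfolding Cl_def
proof (rule partial_order.partial_order_subset[OF map_order_partial_order])
  show "{f. closure_operator L f} \<subseteq> carrier (map_order L)"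
    by (auto simp: map_order_def closure_operator_def preclosure_map_def)
qed

end

lemma powerset_order_partial_order: "partial_order (powerset_order A)"
  by unfold_locales (auto simp: powerset_order_def)

text \<open>The least member of \<C> containing \<open>X\<close> is the intersection of all members
  containing \<open>X\<close>. The factor \<open>A\<close> turns the intersection of the empty
  family into \<open>A\<close> instead of \<open>UNIV\<close>.\<close>

lemma closure_system_powersetI:
  assumes \<C>: "\<C> \<subseteq> Pow A" and Inter: "\<And>\<A>. \<A> \<subseteq> \<C> \<Longrightarrow> A \<inter> \<Inter>\<A> \<in> \<C>"
  shows "closure_system (powerset_order A) \<C>"
proof -
  interpret partial_order "powerset_order A" by (rule powerset_order_partial_order)
  show ?thesis
  proof (rule closure_systemI)
    show "\<C> \<subseteq> carrier (powerset_order A)"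
      using \<C> by (simp add: powerset_order_def)
    fix X assume "X \<in> carrier (powerset_order A)"
    then have "least (powerset_order A) (A \<inter> \<Inter>{C \<in> \<C>. X \<subseteq> C}) {C \<in> \<C>. X \<subseteq> C}"
      using \<C> Inter[of "{C \<in> \<C>. X \<subseteq> C}"] by (auto simp: least_def powerset_order_def)
    then show "\<exists>K. least (powerset_order A) K {C \<in> \<C>. X \<sqsubseteq>\<^bsub>powerset_order A\<^esub> C}"
      by (auto simp: powerset_order_def)
  qed
qed

text \<open>Since \<open>f\<close> is an order-reversing bijection, the preimage of an infimum of
  the image of \<open>X\<close> is a supremum of \<open>X\<close>, and dually.\<close>

lemma complete_lattice_antiiso:
  assumes A: "partial_order A" and B: "complete_lattice B" and f: "order_antiiso A B f"
  shows "complete_lattice A"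
proof -
  interpret A: partial_order A by fact
  interpret B: complete_lattice B by fact
  have img: "f ` carrier A = carrier B" using f by (simp add: order_antiiso_def bij_betw_def)
  have emb: "f y \<sqsubseteq>\<^bsub>B\<^esub> f x \<longleftrightarrow> x \<sqsubseteq>\<^bsub>A\<^esub> y" if "x \<in> carrier A" "y \<in> carrier A" for x y
    using f that by (simp add: order_antiiso_def order_emb_def)
  show ?thesis
  proof (rule A.complete_latticeI)
    fix X assume X: "X \<subseteq> carrier A"
    then have fX: "f ` X \<subseteq> carrier B" using img by blast
    obtain i where i: "is_glb B i (f ` X)" using B.inf_exists[OF fX] by blast
    then have "i \<in> carrier B" by blast
    with img obtain s where s: "s \<in> carrier A" and fs: "f s = i" by (metis imageE)
    have "is_lub A s X"
    proof (rule least_UpperI)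
      show "x \<sqsubseteq>\<^bsub>A\<^esub> s" if "x \<in> X" for x
        using greatest_Lower_below[OF i _ fX] that X s fs emb by blast
      show "s \<sqsubseteq>\<^bsub>A\<^esub> y" if y: "y \<in> Upper A X" for y
      proof -
        have yA: "y \<in> carrier A" using y by (simp add: Upper_def)
        \<comment> \<open>Order reversal sends an upper bound of \<open>X\<close> to a lower bound
          of the image of \<open>X\<close>.\<close>
        have "f y \<in> Lower B (f ` X)"
          using y X yA emb img by (intro Lower_memI) (auto simp: subset_iff)
        then show ?thesis using greatest_le[OF i] fs emb s yA by blast
      qed
    qed (use X s in auto)
    then show "\<exists>s. is_lub A s X" ..
    obtain j where j: "is_lub B j (f ` X)" using B.sup_exists[OF fX] by blast
    then have "j \<in> carrier B" by blast
    with img obtain t where t: "t \<in> carrier A" and ft: "f t = j" by (metis imageE)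
    have "is_glb A t X"
    proof (rule greatest_LowerI)
      show "t \<sqsubseteq>\<^bsub>A\<^esub> x" if "x \<in> X" for x
        using least_Upper_above[OF j _ fX] that X t ft emb by blast
      show "y \<sqsubseteq>\<^bsub>A\<^esub> t" if y: "y \<in> Lower A X" for y
      proof -
        have yA: "y \<in> carrier A" using y by (simp add: Lower_def)
        have "f y \<in> Upper B (f ` X)"
          using y X yA emb img by (intro Upper_memI) (auto simp: subset_iff)
        then show ?thesis using least_le[OF j] ft emb t yA by blast
      qed
    qed (use X t in auto)
    then show "\<exists>t. is_glb A t X" ..
  qed
qed

section \<open>Default-enabled posets\<close>

lemma obeys_default_rulesD:
  assumes "\<forall>r\<in>default_closure_rules P. obeys C r" and "C \<subseteq> carrier P"
    and "B \<subseteq> C" and "maximal_in P c (Lower P B)"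
  shows "c \<in> C"
proof -
  have "c \<in> carrier P" using assms(4) by (auto simp: maximal_in_def Lower_def)
  then have "(B, c) \<in> default_closure_rules P"
    using assms by (auto simp: default_closure_rules_def closure_rules_def)
  then show ?thesis using assms by (force simp: obeys_def)
qed

lemma (in partial_order) fps_obeys_default_rules:
  assumes g: "preclosure_map L g" and r: "r \<in> default_closure_rules L"
  shows "obeys (fps L g) r"
proof -
  obtain B c where r_eq: "r = (B, c)" and B: "B \<subseteq> carrier L" and c: "c \<in> carrier L"
    and max: "maximal_in L c (Lower L B)"
    using r by (auto simp: default_closure_rules_def closure_rules_def)
  have "c \<in> fps L g" if fixed: "B \<subseteq> fps L g"
  proof -
    have "g c \<sqsubseteq> b" if b: "b \<in> B" for b
    proof -
      have "c \<sqsubseteq> b" using max b B by (auto simp: maximal_in_def)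
      then have "g c \<sqsubseteq> g b" using preclosure_mapD(4)[OF g] c b B by blast
      then show ?thesis using fixed b by (auto simp: fps_eq)
    qed
    then have "g c \<in> Lower L B" using preclosure_mapD(1)[OF g] c by (intro Lower_memI)
    then have "g c = c"
      using max preclosure_mapD(3)[OF g c] by (auto simp: maximal_in_def)
    with c show ?thesis by (simp add: fps_eq)
  qed
  then show ?thesis by (simp add: obeys_def r_eq)
qed

context default_enabled
begin

lemma closure_system_iff_obeys:
  assumes C: "C \<subseteq> carrier P"
  shows "closure_system P C \<longleftrightarrow> (\<forall>r\<in>default_closure_rules P. obeys C r)"
proof
  assume "closure_system P C"
  then show "\<forall>r\<in>default_closure_rules P. obeys C r"
    using fps_obeys_default_rules closure_operatorD(1) by (auto simp: closure_system_def)
next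
  assume obeys: "\<forall>r\<in>default_closure_rules P. obeys C r"
  show "closure_system P C"
  proof (rule closure_systemI[OF C])
    fix x assume x: "x \<in> carrier P"
    let ?B = "{y \<in> C. x \<sqsubseteq> y}"
    have B: "?B \<subseteq> carrier P" using C by blast
    have "x \<in> Lower P ?B" using x by (intro Lower_memI) auto
    then obtain c where max: "maximal_in P c (Lower P ?B)" and xc: "x \<sqsubseteq> c"
      using Lower_has_ceiling[OF B] by (auto simp: has_ceiling_def)
    \<comment> \<open>The rule applied is \<open>(?B, c)\<close>. If \<open>?B\<close> were empty,
      \<open>c\<close> would be a maximal element of \<open>P\<close> and the rule
      \<open>({}, c)\<close> would still put it into \<open>C\<close>; so some element of
      \<open>C\<close> always lies above \<open>x\<close>.\<close>
    have "c \<in> C" by (rule obeys_default_rulesD[OF obeys C _ max]) blast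
    moreover have "c \<sqsubseteq> y" if "y \<in> ?B" for y
      using max B that by (auto simp: maximal_in_def)
    ultimately have "least P c ?B" using xc B by (simp add: least_def)
    then show "\<exists>c. least P c ?B" ..
  qed
qed

lemma closure_system_fps: "preclosure_map P g \<Longrightarrow> closure_system P (fps P g)"
  by (simp add: closure_system_iff_obeys fps_obeys_default_rules)

lemma closure_system_subset: "closure_system P C \<Longrightarrow> C \<subseteq> carrier P"
  by (auto simp: closure_system_def fps_eq)

section \<open>The lattices of closure systems and of closure operators\<close>

lemma carrier_ClSys: "carrier (ClSys P) = {C. closure_system P C}"
  by (simp add: ClSys_def)

lemma le_ClSys: "X \<sqsubseteq>\<^bsub>ClSys P\<^esub> Y \<longleftrightarrow> X \<subseteq> Y"
  by (simp add: ClSys_def powerset_order_def)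

lemma carrier_Cl: "carrier (Cl P) = {f. closure_operator P f}"
  by (simp add: Cl_def)

lemma le_Cl: "f \<sqsubseteq>\<^bsub>Cl P\<^esub> g \<longleftrightarrow> (\<forall>x\<in>carrier P. f x \<sqsubseteq> g x)"
  by (simp add: Cl_def map_order_def)

text \<open>Sets obeying a given rule are stable under intersection, and closure systems are exactly
  the sets obeying all default rules.\<close>

lemma Inter_mem_ClSys:
  assumes \<A>: "\<A> \<subseteq> carrier (ClSys P)"
  shows "carrier P \<inter> \<Inter>\<A> \<in> carrier (ClSys P)"
proof -
  have "obeys (carrier P \<inter> \<Inter>\<A>) r" if r: "r \<in> default_closure_rules P" for r
  proof -
    have "obeys A r" if "A \<in> \<A>" for A
      using \<A> that r closure_system_iff_obeys[OF closure_system_subset]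
      by (auto simp: carrier_ClSys)
    \<comment> \<open>This treats the factor \<open>carrier P\<close>, which alone remains when the
      family is empty.\<close>
    moreover have "snd r \<in> carrier P"
      using r by (auto simp: default_closure_rules_def closure_rules_def)
    ultimately show ?thesis by (auto simp: obeys_def)
  qed
  then show ?thesis by (simp add: carrier_ClSys closure_system_iff_obeys)
qed

lemma ClSys_partial_order: "partial_order (ClSys P)"
  unfolding ClSys_def
  by (rule partial_order.partial_order_subset[OF powerset_order_partial_order])
    (use closure_system_subset in \<open>auto simp: powerset_order_def\<close>)

lemma Inter_is_glb_ClSys:
  assumes \<A>: "\<A> \<subseteq> carrier (ClSys P)"
  shows "is_glb (ClSys P) (carrier P \<inter> \<Inter>\<A>) \<A>"
proof (rule greatest_LowerI[OF _ _ \<A> Inter_mem_ClSys[OF \<A>]])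
  fix C assume C: "C \<in> Lower (ClSys P) \<A>"
  then have "C \<subseteq> carrier P"
    by (simp add: Lower_def carrier_ClSys closure_system_subset)
  moreover have "C \<subseteq> A" if "A \<in> \<A>" for A
    using Lower_memD[OF C that \<A>] by (simp add: le_ClSys)
  ultimately show "C \<sqsubseteq>\<^bsub>ClSys P\<^esub> carrier P \<inter> \<Inter>\<A>" by (auto simp: le_ClSys)
qed (auto simp: le_ClSys)

lemma ClSys_complete_lattice: "complete_lattice (ClSys P)"
proof (rule partial_order.complete_lattice_criterion1[OF ClSys_partial_order])
  show "\<exists>C. greatest (ClSys P) C (carrier (ClSys P))"
    \<comment> \<open>Every closure system is a lower bound of the empty family, so the infimum of
      that family, \<open>carrier P\<close>, is the greatest element.\<close>
    using Inter_is_glb_ClSys[of "{}"] by auto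
  show "\<exists>C. is_glb (ClSys P) C \<A>" if "\<A> \<subseteq> carrier (ClSys P)" for \<A>
    using Inter_is_glb_ClSys[OF that] ..
qed

text \<open>Surjectivity is the definition of a closure system, and injectivity is
  \<open>closure_operator_eqI\<close>. The two comparison lemmas for fixpoint sets give the two
  directions of order reversal.\<close>

lemma fps_antiiso: "order_antiiso (Cl P) (ClSys P) (fps P)"
  unfolding order_antiiso_def order_emb_def
proof (intro conjI ballI)
  show "bij_betw (fps P) (carrier (Cl P)) (carrier (ClSys P))"
    unfolding bij_betw_def
  proof
    show "inj_on (fps P) (carrier (Cl P))"
      by (rule inj_onI) (simp add: carrier_Cl closure_operator_eqI)
    show "fps P ` carrier (Cl P) = carrier (ClSys P)"
      by (auto simp: carrier_Cl carrier_ClSys closure_system_def)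
  qed
  show "weak_partial_order (Cl P)"
    by (rule partial_order.axioms(1)[OF Cl_partial_order])
  show "weak_partial_order (inv_gorder (ClSys P))"
    by (rule partial_order.axioms(1)[OF partial_order.dual_order[OF ClSys_partial_order]])
  fix f g assume "f \<in> carrier (Cl P)" "g \<in> carrier (Cl P)"
  then have f: "closure_operator P f" and g: "closure_operator P g"
    by (simp_all add: carrier_Cl)
  note f' = closure_operatorD(1)[OF f] and g' = closure_operatorD(1)[OF g]
  have "fps P g \<subseteq> fps P f \<longleftrightarrow> (\<forall>x\<in>carrier P. f x \<sqsubseteq> g x)"
    using fps_antimono[OF f' g'] preclosure_map_le_closure_operator[OF f' g] by blast
  then show "fps P f \<sqsubseteq>\<^bsub>inv_gorder (ClSys P)\<^esub> fps P g \<longleftrightarrow> f \<sqsubseteq>\<^bsub>Cl P\<^esub> g"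
    by (simp add: le_ClSys le_Cl)
qed

text \<open>Equal fixpoint sets give \<open>g\<close> below \<open>h\<close>. A closure operator
  \<open>k\<close> above \<open>g\<close> has its fixed points among those of \<open>g\<close>,
  which are those of \<open>h\<close>, so \<open>h\<close> lies below \<open>k\<close>.\<close>

lemma closure_operator_least_above:
  assumes g: "preclosure_map P g" and h: "closure_operator P h" and eq: "fps P h = fps P g"
  shows "least (map_order P) h {k. closure_operator P k \<and> g \<sqsubseteq>\<^bsub>map_order P\<^esub> k}"
  unfolding least_def
proof (intro conjI ballI)
  show "{k. closure_operator P k \<and> g \<sqsubseteq>\<^bsub>map_order P\<^esub> k} \<subseteq> carrier (map_order P)"
    by (auto simp: map_order_def closure_operator_def preclosure_map_def)
  show "h \<in> {k. closure_operator P k \<and> g \<sqsubseteq>\<^bsub>map_order P\<^esub> k}"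
    using preclosure_map_le_closure_operator[OF g h] h eq by (simp add: map_order_def)
  fix k assume k: "k \<in> {k. closure_operator P k \<and> g \<sqsubseteq>\<^bsub>map_order P\<^esub> k}"
  then have "fps P k \<subseteq> fps P h"
    unfolding eq by (intro fps_antimono g) (auto simp: map_order_def dest: closure_operatorD)
  then show "h \<sqsubseteq>\<^bsub>map_order P\<^esub> k"
    using preclosure_map_le_closure_operator[OF closure_operatorD(1)[OF h]] k
    by (simp add: map_order_def)
qed

end

theorem proposition8p3:
  fixes P :: "('a, 'b) gorder_scheme"
  assumes "default_enabled P"
  shows
    "(\<forall>g. preclosure_map P g \<longrightarrow>
        closure_system P (fps P g) \<and>
        (\<exists>!h. closure_operator P h \<and> fps P h = fps P g) \<and>
        (\<forall>h. closure_operator P h \<and> fps P h = fps P g \<longrightarrow>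
          least (map_order P) h {k. closure_operator P k \<and> g \<sqsubseteq>\<^bsub>map_order P\<^esub> k})) \<and>
     (\<forall>C. C \<subseteq> carrier P \<longrightarrow>
        (closure_system P C \<longleftrightarrow> (\<forall>r\<in>default_closure_rules P. obeys C r))) \<and>
     closure_system (powerset_order (carrier P)) (carrier (ClSys P)) \<and>
     (\<forall>\<A>. \<A> \<subseteq> carrier (ClSys P) \<longrightarrow> carrier P \<inter> \<Inter>\<A> \<in> carrier (ClSys P)) \<and>
     complete_lattice (ClSys P) \<and>
     (\<forall>\<A>. \<A> \<subseteq> carrier (ClSys P) \<longrightarrow> is_glb (ClSys P) (carrier P \<inter> \<Inter>\<A>) \<A>) \<and>
     order_antiiso (Cl P) (ClSys P) (fps P) \<and>
     complete_lattice (Cl P)"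
proof -
  interpret default_enabled P by fact
  \<comment> \<open>Existence unfolds the fact that \<open>fps P g\<close> is a closure system;
    uniqueness holds because a closure operator is determined by its fixed points.\<close>
  have ex1: "\<exists>!h. closure_operator P h \<and> fps P h = fps P g" if "preclosure_map P g" for g
    using closure_system_fps[OF that] closure_operator_eqI unfolding closure_system_def by metis
  have clsys: "closure_system (powerset_order (carrier P)) (carrier (ClSys P))"
    using closure_system_subset Inter_mem_ClSys
    by (intro closure_system_powersetI) (auto simp: carrier_ClSys)
  have Cl: "complete_lattice (Cl P)"
    by (rule complete_lattice_antiiso[OF Cl_partial_order ClSys_complete_lattice fps_antiiso])
  show ?thesis
    by (intro conjI allI impI ex1 clsys Cl closure_system_fps closure_system_iff_obeys
        Inter_mem_ClSys Inter_is_glb_ClSys ClSys_complete_lattice fps_antiiso)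
      (auto intro: closure_operator_least_above)
qed

end
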